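(* Consider the Probabilistic Serial mechanism with $n$ agents and $m$ items, where $n \ge m$. Let $i$ be any agent whose true preferences are a strict linear order $\succ_i$ over the $m$ items together with cardinal utilities $a_{ij} \in [0,1]$ compatible with $\succ_i$ (i.e. $a_{ij} > a_{ij'}$ whenever $j \succ_i j'$). Fix arbitrary reported strict linear orders $\succ_{-i}$ of all other agents. Then for every strict linear order $\succ'_i$ over the items, $$u_i(\succ'_i, \succ_{-i}) \le \tfrac{3}{2}\, u_i(\succ_i, \succ_{-i}).$$ Equivalently, the incentive ratio of the Probabilistic Serial mechanism is at most $\tfrac{3}{2}$ when $n \ge m$.
   Context: There are $n$ agents and $m$ divisible items, each of unit supply. Each agent reports a strict linear order over all $m$ items. The Probabilistic Serial mechanism runs the simultaneous eating algorithm: starting at time $0$, every agent consumes, at rate $1$ (one unit of item per unit of time), its most preferred item (according to its report) among the items with positive remaining supply; whenever an item is exhausted, each agent consuming it moves on to its most preferred item still having positive remaining supply; this continues until all items are exhausted. Let $x_{ij}$ be the total amount of item $j$ consumed by agent $i$. The (expected) utility of agent $i$ with cardinal utilities $a_{ij}$ is $u_i = \sum_j a_{ij} x_{ij}$; $u_i(\succ'_i,\succ_{-i})$ denotes this utility (computed with agent $i$'s true $a_{ij}$) when agent $i$ reports $\succ'_i$ and the others report $\succ_{-i}$. The incentive ratio of agent $i$ is $\max_{\succ_{-i}} \max_{\succ'_i} u_i(\succ'_i,\succ_{-i})/u_i(\succ_i,\succ_{-i})$, and the incentive ratio of the mechanism is the maximum over agents. *)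

theory Defs
  imports Main Complex_Main
begin

text \<open>Agents are 0..<n, items are 0..<m. A (strict linear) preference order over the
items is a list enumerating 0..<m exactly once, most preferred first.\<close>

definition valid_pref :: "nat \<Rightarrow> nat list \<Rightarrow> bool" where
  "valid_pref m p \<longleftrightarrow> distinct p \<and> set p = {0..<m}"

definition top_item :: "nat list \<Rightarrow> nat set \<Rightarrow> nat" where
  "top_item p A = hd (filter (\<lambda>j. j \<in> A) p)"

definition eaters :: "nat \<Rightarrow> (nat \<Rightarrow> nat list) \<Rightarrow> nat set \<Rightarrow> nat \<Rightarrow> nat" where
  "eaters n P A j = card {k. k < n \<and> top_item (P k) A = j}"

text \<open>One phase of the simultaneous eating algorithm. State: remaining supply s and
amounts x k j eaten so far. Every agent eats its top available item at rate 1 until the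
first available item is exhausted (after time t).\<close>
definition ps_step :: "nat \<Rightarrow> nat \<Rightarrow> (nat \<Rightarrow> nat list) \<Rightarrow>
    (nat \<Rightarrow> real) \<times> (nat \<Rightarrow> nat \<Rightarrow> real) \<Rightarrow> (nat \<Rightarrow> real) \<times> (nat \<Rightarrow> nat \<Rightarrow> real)" where
  "ps_step n m P st =
     (let s = fst st; x = snd st;
          A = {j. j < m \<and> s j > 0};
          E = eaters n P A;
          D = {j \<in> A. E j > 0}
      in if D = {} then st
         else let t = Min ((\<lambda>j. s j / real (E j)) ` D)
              in (\<lambda>j. if j \<in> A then s j - t * real (E j) else s j,
                  \<lambda>k j. if k < n \<and> j \<in> A \<and> j = top_item (P k) A then x k j + t else x k j))"

text \<open>Each phase exhausts at least one item, so m phases run the algorithm to completion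
(afterwards ps_step is the identity). ps_alloc n m P k j is the amount of item j
consumed by agent k.\<close>
definition ps_alloc :: "nat \<Rightarrow> nat \<Rightarrow> (nat \<Rightarrow> nat list) \<Rightarrow> nat \<Rightarrow> nat \<Rightarrow> real" where
  "ps_alloc n m P = snd ((ps_step n m P ^^ m) (\<lambda>j. 1, \<lambda>k j. 0))"

definition ps_util :: "nat \<Rightarrow> nat \<Rightarrow> (nat \<Rightarrow> nat list) \<Rightarrow> (nat \<Rightarrow> real) \<Rightarrow> nat \<Rightarrow> real" where
  "ps_util n m P a i = (\<Sum>j<m. a j * ps_alloc n m P i j)"

definition compatible_utils :: "nat \<Rightarrow> nat list \<Rightarrow> (nat \<Rightarrow> real) \<Rightarrow> bool" where
  "compatible_utils m p a \<longleftrightarrow>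
     (\<forall>j<m. 0 \<le> a j \<and> a j \<le> 1) \<and>
     (\<forall>r q. r < q \<and> q < length p \<longrightarrow> a (p ! r) > a (p ! q))"

end

theory Submission
  imports Defs
begin

text \<open>
  By Abel summation it suffices to bound, for every set S of top items of agent i, the amount L of
  S that i obtains by lying by 3/2 times the time T at which S is exhausted under truth-telling;
  truthfully, i eats only S until T and so obtains T units of it.

  Run the truthful and the manipulated process synchronously. The excess of the manipulated supply
  over the truthful one, summed over the items where it is positive, grows at rate at most 1: an
  agent other than i who truthfully eats an item in excess also eats an item in excess in the
  manipulated process. Hence at time T the items X already exhausted under truth have at most T
  units left in the manipulated process. If T < 1, every item j of S was truthfully eaten also by
  some agent k other than i, and everything k prefers to j lies in X. So whenever the manipulator
  eats j after T, agent k eats from X as well, and i obtains at most half of the remaining T units: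
  L is at most T + T/2. If T is at least 1, then L is at most m/n, which is at most 1, since every
  agent eats for time m/n only.
\<close>

section \<open>Available items, phases and flows\<close>

definition avail :: "nat \<Rightarrow> (nat \<Rightarrow> real) \<times> (nat \<Rightarrow> nat \<Rightarrow> real) \<Rightarrow> nat set" where
  "avail m st = {j. j < m \<and> fst st j > 0}"

definition flow :: "nat \<Rightarrow> nat \<Rightarrow> (nat \<Rightarrow> nat list) \<Rightarrow> real \<Rightarrow>
    (nat \<Rightarrow> real) \<times> (nat \<Rightarrow> nat \<Rightarrow> real) \<Rightarrow> (nat \<Rightarrow> real) \<times> (nat \<Rightarrow> nat \<Rightarrow> real)" where
  "flow n m P h st =
     (\<lambda>j. fst st j - h * real (eaters n P (avail m st) j),
      \<lambda>k j. snd st k j + (if k < n \<and> j = top_item (P k) (avail m st) then h else 0))"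

definition phase_len :: "nat \<Rightarrow> nat \<Rightarrow> (nat \<Rightarrow> nat list) \<Rightarrow>
    (nat \<Rightarrow> real) \<times> (nat \<Rightarrow> nat \<Rightarrow> real) \<Rightarrow> real" where
  "phase_len n m P st =
     Min ((\<lambda>j. fst st j / real (eaters n P (avail m st) j)) `
       {j \<in> avail m st. eaters n P (avail m st) j > 0})"

text \<open>The inequality is weak so that a full phase, which brings some item exactly to zero, is
  allowed. Nonemptiness excludes states where \<open>top_item\<close> is the unspecified
  \<open>hd []\<close>.\<close>

definition feasible :: "nat \<Rightarrow> nat \<Rightarrow> (nat \<Rightarrow> nat list) \<Rightarrow> real \<Rightarrow>
    (nat \<Rightarrow> real) \<times> (nat \<Rightarrow> nat \<Rightarrow> real) \<Rightarrow> bool" where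
  "feasible n m P h st \<longleftrightarrow> avail m st \<noteq> {} \<and> 0 \<le> h \<and>
     (\<forall>j\<in>avail m st. h * real (eaters n P (avail m st) j) \<le> fst st j)"

definition better :: "nat list \<Rightarrow> nat \<Rightarrow> nat set" where
  "better p j = set (takeWhile (\<lambda>j'. j' \<noteq> j) p)"

lemma finite_avail [simp]: "finite (avail m st)"
  by (simp add: avail_def)

lemma ps_step_avail:
  "ps_step n m P st =
     (let A = avail m st; E = eaters n P A; D = {j \<in> A. E j > 0}
      in if D = {} then st
         else let t = Min ((\<lambda>j. fst st j / real (E j)) ` D)
              in (\<lambda>j. if j \<in> A then fst st j - t * real (E j) else fst st j,
                  \<lambda>k j. if k < n \<and> j \<in> A \<and> j = top_item (P k) A
                    then snd st k j + t else snd st k j))"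
  unfolding ps_step_def avail_def Let_def by (rule refl)

section \<open>Top items and the items preferred to them\<close>

lemma filter_eq_Nil_iff_disjoint: "filter (\<lambda>j. j \<in> A) p = [] \<longleftrightarrow> set p \<inter> A = {}"
  by (auto simp: filter_empty_conv)

lemma top_item_mem:
  assumes "set p \<inter> A \<noteq> {}"
  shows "top_item p A \<in> set p \<inter> A"
proof -
  have "filter (\<lambda>j. j \<in> A) p \<noteq> []"
    using assms by (simp only: filter_eq_Nil_iff_disjoint not_False_eq_True)
  then have "top_item p A \<in> set (filter (\<lambda>j. j \<in> A) p)"
    unfolding top_item_def by (rule hd_in_set)
  then show ?thesis by simp
qed

lemma top_item_prefix:
  assumes "set (take r p) \<inter> A \<noteq> {}"
  shows "top_item p A \<in> set (take r p)"
proof -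
  have "filter (\<lambda>j. j \<in> A) (take r p) \<noteq> []"
    using assms by (simp only: filter_eq_Nil_iff_disjoint not_False_eq_True)
  moreover have "filter (\<lambda>j. j \<in> A) p = filter (\<lambda>j. j \<in> A) (take r p) @ filter (\<lambda>j. j \<in> A) (drop r p)"
    by (metis append_take_drop_id filter_append)
  ultimately have "top_item p A = top_item (take r p) A"
    by (simp add: top_item_def)
  then show ?thesis using top_item_mem[OF assms] by simp
qed

lemma top_item_weakly_better:
  assumes "j \<in> A" "j \<in> set p"
  shows "top_item p A \<in> insert j (better p j)"
  using assms
proof (induction p)
  case (Cons b p)
  then show ?case by (auto simp: top_item_def better_def)
qed simp

text \<open>Entries before the first member of \<open>A\<close> lie outside \<open>A\<close>. If
  \<open>p\<close> misses \<open>A\<close>, the top item is unspecified, but \<open>better\<close>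
  stays within \<open>set p\<close> and so still misses \<open>A\<close>.\<close>

lemma better_top_item_disjoint:
  "better p (top_item p A) \<inter> A = {}"
proof (induction p)
  case (Cons b p)
  then show ?case by (auto simp: top_item_def better_def)
qed (simp add: better_def)

lemma valid_pref_mem: "valid_pref m p \<Longrightarrow> j \<in> set p \<longleftrightarrow> j < m"
  by (simp add: valid_pref_def)

lemma valid_pref_better: "valid_pref m p \<Longrightarrow> j' \<in> better p j \<Longrightarrow> j' < m"
  unfolding better_def by (drule set_takeWhileD) (simp add: valid_pref_mem)

lemma valid_pref_prefix: "valid_pref m p \<Longrightarrow> set (take r p) \<subseteq> {..<m}"
  by (auto simp: valid_pref_mem dest: in_set_takeD)

lemma top_item_avail:
  assumes "valid_pref m p" "avail m st \<noteq> {}"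
  shows "top_item p (avail m st) \<in> avail m st"
proof -
  have "set p \<inter> avail m st = avail m st"
    using valid_pref_mem[OF assms(1)] by (auto simp: avail_def)
  with top_item_mem[of p "avail m st"] assms(2) show ?thesis by simp
qed

lemma sum_eaters:
  assumes "finite X"
  shows "(\<Sum>j\<in>X. eaters n P A j) = card {k. k < n \<and> top_item (P k) A \<in> X}"
proof -
  have "{k. k < n \<and> top_item (P k) A \<in> X} = (\<Union>j\<in>X. {k. k < n \<and> top_item (P k) A = j})"
    by auto
  then show ?thesis
    unfolding eaters_def using assms
    by (simp, subst card_UN_disjoint) auto
qed

lemma sum_supply_flow:
  assumes "finite X"
  shows "(\<Sum>j\<in>X. fst (flow n m P h st) j) =
    (\<Sum>j\<in>X. fst st j) - h * real (card {k. k < n \<and> top_item (P k) (avail m st) \<in> X})"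
  by (simp add: flow_def sum_subtractf sum_distrib_left[symmetric]
      sum_eaters[OF assms, symmetric])

lemma sum_eaten_flow:
  assumes "finite X" "k < n"
  shows "(\<Sum>j\<in>X. snd (flow n m P h st) k j) =
    (\<Sum>j\<in>X. snd st k j) + (if top_item (P k) (avail m st) \<in> X then h else 0)"
  using assms by (simp add: flow_def sum.distrib)

section \<open>Runs of one process and of two synchronised processes\<close>

abbreviation (input) ps_init :: "(nat \<Rightarrow> real) \<times> (nat \<Rightarrow> nat \<Rightarrow> real)" where
  "ps_init \<equiv> (\<lambda>j. 1, \<lambda>k j. 0)"

text \<open>Invariants are proved once for a single process and its clock, then applied to both
  components of a joint run.\<close>

inductive run :: "nat \<Rightarrow> nat \<Rightarrow> (nat \<Rightarrow> nat list) \<Rightarrow> real \<Rightarrow>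
    (nat \<Rightarrow> real) \<times> (nat \<Rightarrow> nat \<Rightarrow> real) \<Rightarrow> bool" for n m P where
  start: "run n m P 0 ps_init"
| step: "run n m P t st \<Longrightarrow> feasible n m P h st \<Longrightarrow> run n m P (t + h) (flow n m P h st)"

text \<open>Steps may be shorter than a phase, so that two processes whose phases end at different times
  can be advanced by a common amount.\<close>
inductive joint_run :: "nat \<Rightarrow> nat \<Rightarrow> (nat \<Rightarrow> nat list) \<Rightarrow> (nat \<Rightarrow> nat list) \<Rightarrow> real \<Rightarrow>
    (nat \<Rightarrow> real) \<times> (nat \<Rightarrow> nat \<Rightarrow> real) \<Rightarrow> (nat \<Rightarrow> real) \<times> (nat \<Rightarrow> nat \<Rightarrow> real) \<Rightarrow> bool"
  for n m P Q where
  start: "joint_run n m P Q 0 ps_init ps_init"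
| step: "joint_run n m P Q t st st' \<Longrightarrow> feasible n m P h st \<Longrightarrow> feasible n m Q h st' \<Longrightarrow>
    joint_run n m P Q (t + h) (flow n m P h st) (flow n m Q h st')"

lemma joint_run_runs:
  assumes "joint_run n m P Q t st st'"
  shows "run n m P t st" "run n m Q t st'"
  using assms by (induction rule: joint_run.induct) (auto intro: run.intros)

section \<open>Full phases versus flows of arbitrary length\<close>

context
  fixes n m :: nat and P :: "nat \<Rightarrow> nat list"
  assumes n_pos: "0 < n" and valid: "\<forall>k<n. valid_pref m (P k)"
begin

lemma eaters_unavailable:
  assumes "avail m st \<noteq> {}" "j \<notin> avail m st"
  shows "eaters n P (avail m st) j = 0"
  using top_item_avail[OF valid[rule_format] assms(1)] assms(2) by (auto simp: eaters_def)

text \<open>Agent 0 always eats something available, so the \<open>Min\<close> in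
  \<open>phase_len\<close> is taken over a nonempty set.\<close>

lemma eaten_items_nonempty:
  assumes "avail m st \<noteq> {}"
  shows "{j \<in> avail m st. eaters n P (avail m st) j > 0} \<noteq> {}"
proof -
  let ?j = "top_item (P 0) (avail m st)"
  have "0 \<in> {k. k < n \<and> top_item (P k) (avail m st) = ?j}" using n_pos by simp
  then have "eaters n P (avail m st) ?j > 0"
    unfolding eaters_def by (subst card_gt_0_iff) auto
  then show ?thesis using top_item_avail[OF valid[rule_format, OF n_pos] assms] by blast
qed

lemma ps_step_eq_flow:
  assumes "avail m st \<noteq> {}"
  shows "ps_step n m P st = flow n m P (phase_len n m P st) st"
proof -
  have "top_item (P k) (avail m st) \<in> avail m st" if "k < n" for k
    using that top_item_avail[OF valid[rule_format] assms] by blast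
  then show ?thesis
    using eaten_items_nonempty[OF assms] eaters_unavailable[OF assms]
    by (auto simp: ps_step_avail Let_def flow_def phase_len_def intro!: ext)
qed

lemma ps_step_exhausted:
  "avail m st = {} \<Longrightarrow> ps_step n m P st = st"
  by (simp add: ps_step_avail)

lemma ps_iterate_exhausted:
  "avail m st = {} \<Longrightarrow> (ps_step n m P ^^ r) st = st"
  by (induction r) (simp_all add: ps_step_exhausted)

lemma phase_len_attained:
  assumes "avail m st \<noteq> {}"
  obtains j where "j \<in> avail m st" "eaters n P (avail m st) j > 0"
    "phase_len n m P st = fst st j / real (eaters n P (avail m st) j)"
proof -
  have "phase_len n m P st \<in> (\<lambda>j. fst st j / real (eaters n P (avail m st) j)) `
       {j \<in> avail m st. eaters n P (avail m st) j > 0}"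
    unfolding phase_len_def by (rule Min_in) (use eaten_items_nonempty[OF assms] in auto)
  then show ?thesis using that by auto
qed

lemma phase_len_le:
  assumes "j \<in> avail m st"
  shows "phase_len n m P st * real (eaters n P (avail m st) j) \<le> fst st j"
proof (cases "eaters n P (avail m st) j > 0")
  case True
  then have "phase_len n m P st \<le> fst st j / real (eaters n P (avail m st) j)"
    unfolding phase_len_def using assms by (intro Min_le) auto
  with True show ?thesis by (simp add: field_simps)
qed (use assms in \<open>auto simp: avail_def\<close>)

lemma phase_len_pos:
  assumes "avail m st \<noteq> {}"
  shows "0 < phase_len n m P st"
  using assms by (rule phase_len_attained) (auto simp: avail_def)

lemma feasible_le_phase_len:
  assumes "avail m st \<noteq> {}" "0 \<le> h" "h \<le> phase_len n m P st"
  shows "feasible n m P h st"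
proof -
  have "h * real (eaters n P (avail m st) j) \<le> fst st j" if "j \<in> avail m st" for j
    using phase_len_le[OF that] assms(3)
    by (meson mult_right_mono of_nat_0_le_iff order_trans)
  with assms show ?thesis by (simp add: feasible_def)
qed

lemma avail_flow_subset:
  assumes "0 \<le> h"
  shows "avail m (flow n m P h st) \<subseteq> avail m st"
proof
  fix j assume "j \<in> avail m (flow n m P h st)"
  moreover have "fst (flow n m P h st) j \<le> fst st j"
    using assms by (simp add: flow_def)
  ultimately show "j \<in> avail m st"
    unfolding avail_def[of m "flow n m P h st"] avail_def[of m st] by auto
qed

lemma avail_flow_eq:
  assumes "avail m st \<noteq> {}" "0 \<le> h" "h < phase_len n m P st"
  shows "avail m (flow n m P h st) = avail m st"
proof
  show "avail m st \<subseteq> avail m (flow n m P h st)"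
  proof
    fix j assume j: "j \<in> avail m st"
    let ?E = "real (eaters n P (avail m st) j)"
    have "h * ?E < fst st j"
    proof (cases "?E = 0")
      case False
      then have "h * ?E < phase_len n m P st * ?E" using assms(3) by simp
      then show ?thesis using phase_len_le[OF j] by linarith
    qed (use j in \<open>simp add: avail_def\<close>)
    with j show "j \<in> avail m (flow n m P h st)"
      by (simp add: avail_def[of _ "flow n m P h st"] flow_def) (simp add: avail_def)
  qed
qed (rule avail_flow_subset[OF assms(2)])

lemma flow_flow:
  assumes "avail m (flow n m P h st) = avail m st"
  shows "flow n m P h' (flow n m P h st) = flow n m P (h + h') st"
  using assms
  by (simp add: flow_def[of _ _ _ h'] flow_def[of _ _ _ "h + h'"])
    (auto simp: flow_def fun_eq_iff algebra_simps)

text \<open>At unchanged rates each quotient \<open>(s - h * E) / E\<close> is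
  \<open>s / E - h\<close>, and \<open>Min\<close> commutes with this monotone shift.\<close>

lemma phase_len_flow:
  assumes "avail m st \<noteq> {}" "avail m (flow n m P h st) = avail m st"
  shows "phase_len n m P (flow n m P h st) = phase_len n m P st - h"
proof -
  let ?E = "eaters n P (avail m st)"
  let ?D = "{j \<in> avail m st. ?E j > 0}"
  have "phase_len n m P (flow n m P h st) = Min ((\<lambda>j. fst (flow n m P h st) j / real (?E j)) ` ?D)"
    by (simp add: phase_len_def assms(2))
  also have "(\<lambda>j. fst (flow n m P h st) j / real (?E j)) ` ?D =
      (\<lambda>v. v - h) ` (\<lambda>j. fst st j / real (?E j)) ` ?D"
    unfolding image_image by (intro image_cong) (auto simp: flow_def field_simps)
  also have "Min \<dots> = phase_len n m P st - h"
    unfolding phase_len_def using eaten_items_nonempty[OF assms(1)]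
    by (intro mono_Min_commute[symmetric]) (auto intro: monoI)
  finally show ?thesis .
qed

text \<open>Before the phase ends the rates are constant, so the cut phase is completed by its
  remaining length. Hence cutting a phase leaves the number of phases still to run
  unchanged.\<close>

lemma ps_step_flow:
  assumes "avail m st \<noteq> {}" "0 \<le> h" "h < phase_len n m P st"
  shows "ps_step n m P (flow n m P h st) = ps_step n m P st"
proof -
  note eq = avail_flow_eq[OF assms]
  have "ps_step n m P (flow n m P h st)
      = flow n m P (phase_len n m P st - h) (flow n m P h st)"
    using assms(1) by (simp add: ps_step_eq_flow eq phase_len_flow)
  also have "\<dots> = ps_step n m P st"
    by (simp add: flow_flow[OF eq] ps_step_eq_flow[OF assms(1)])
  finally show ?thesis .
qed

text \<open>The item attaining the minimum in \<open>phase_len\<close> drops to zero, and no item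
  becomes available again.\<close>

lemma card_avail_ps_step:
  assumes "avail m st \<noteq> {}"
  shows "card (avail m (ps_step n m P st)) < card (avail m st)"
proof -
  obtain j where j: "j \<in> avail m st" "eaters n P (avail m st) j > 0"
    "phase_len n m P st = fst st j / real (eaters n P (avail m st) j)"
    using assms by (rule phase_len_attained)
  then have "fst (ps_step n m P st) j = 0"
    by (simp add: ps_step_eq_flow[OF assms] flow_def)
  then have "j \<notin> avail m (ps_step n m P st)"
    by (simp add: avail_def)
  moreover have "avail m (ps_step n m P st) \<subseteq> avail m st"
    using avail_flow_subset[of "phase_len n m P st" st] phase_len_pos[OF assms]
    by (simp add: ps_step_eq_flow[OF assms])
  ultimately have "avail m (ps_step n m P st) \<subset> avail m st" using j(1) by blast
  then show ?thesis by (simp add: psubset_card_mono)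
qed

lemma avail_ps_iterate:
  assumes "card (avail m st) \<le> r"
  shows "avail m ((ps_step n m P ^^ r) st) = {}"
  using assms
proof (induction r arbitrary: st)
  case (Suc r)
  show ?case
  proof (cases "avail m st = {}")
    case True
    then show ?thesis by (simp only: ps_iterate_exhausted)
  next
    case False
    from card_avail_ps_step[OF this] Suc.prems
    have "card (avail m (ps_step n m P st)) \<le> r" by linarith
    from Suc.IH[OF this] show ?thesis by (simp add: funpow_swap1)
  qed
qed (simp)

section \<open>Conservation laws and exhaustion in a single run\<close>

lemma run_supply_nonneg:
  assumes "run n m P t st"
  shows "0 \<le> fst st j"
  using assms
proof (induction arbitrary: j rule: run.induct)
  case (step t st h)
  then show ?case
    using eaters_unavailable[of st j]
    by (cases "j \<in> avail m st") (auto simp: feasible_def flow_def)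
qed simp

lemma run_eaten_nonneg:
  assumes "run n m P t st"
  shows "0 \<le> snd st k j"
  using assms
  by (induction rule: run.induct) (auto simp: feasible_def flow_def)

lemma run_item_balance:
  assumes "run n m P t st"
  shows "(\<Sum>k<n. snd st k j) = 1 - fst st j"
  using assms
proof (induction rule: run.induct)
  case (step t st h)
  have "(\<Sum>k<n. if j = top_item (P k) (avail m st) then h else 0)
      = (\<Sum>k | k < n \<and> top_item (P k) (avail m st) = j. h)"
    by (intro sum.mono_neutral_cong_right) auto
  also have "\<dots> = h * real (eaters n P (avail m st) j)"
    by (simp add: eaters_def)
  finally have "(\<Sum>k<n. if j = top_item (P k) (avail m st) then h else 0)
      = h * real (eaters n P (avail m st) j)" .
  then show ?case using step.IH by (simp add: flow_def sum.distrib)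
qed simp

lemma run_agent_total:
  assumes "run n m P t st" "k < n"
  shows "(\<Sum>j<m. snd st k j) = t"
  using assms
proof (induction rule: run.induct)
  case (step t st h)
  have "top_item (P k) (avail m st) < m"
    using top_item_avail[OF valid[rule_format, OF step.prems]] step.hyps(2) by (auto simp: feasible_def avail_def)
  then show ?case
    using step by (simp add: sum_eaten_flow)
qed simp

lemma run_total:
  assumes "run n m P t st"
  shows "(\<Sum>j<m. fst st j) = real m - real n * t"
proof -
  have "(\<Sum>j<m. 1 - fst st j) = (\<Sum>k<n. \<Sum>j<m. snd st k j)"
    by (subst sum.swap) (simp add: run_item_balance[OF assms])
  also have "\<dots> = real n * t"
    using run_agent_total[OF assms] by simp
  finally show ?thesis by (simp add: sum_subtractf)
qed

text \<open>Supplies are nonnegative and their total falls at rate \<open>n\<close>, so exhaustion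
  occurs at time m/n whatever the reports. Two synchronised processes therefore end
  together.\<close>

lemma run_avail_empty_iff:
  assumes "run n m P t st"
  shows "avail m st = {} \<longleftrightarrow> real n * t = real m"
proof -
  have "avail m st = {} \<longleftrightarrow> (\<forall>j<m. fst st j = 0)"
    using run_supply_nonneg[OF assms] by (force simp: avail_def less_le)
  also have "\<dots> \<longleftrightarrow> (\<Sum>j<m. fst st j) = 0"
    by (subst sum_nonneg_eq_0_iff) (auto intro: run_supply_nonneg[OF assms])
  finally show ?thesis using run_total[OF assms] by auto
qed

lemma run_eaten_imp_better_exhausted:
  assumes "run n m P t st" "k < n" "0 < snd st k j" "j' \<in> better (P k) j"
  shows "fst st j' = 0"
  using assms
proof (induction rule: run.induct)
  case (step t st h)
  from step.hyps(2) have ne: "avail m st \<noteq> {}" by (simp add: feasible_def)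
  have "j' < m"
    using valid[rule_format, OF step.prems(1)] step.prems(3) by (rule valid_pref_better)
  have "fst st j' = 0"
  proof (cases "j = top_item (P k) (avail m st)")
    case True
    then have "j' \<notin> avail m st" using better_top_item_disjoint step.prems(3) by blast
    then show ?thesis
      using \<open>j' < m\<close> run_supply_nonneg[OF step.hyps(1), of j'] by (simp add: avail_def)
  next
    case False
    then show ?thesis using step.IH step.prems by (simp add: flow_def)
  qed
  then have "j' \<notin> avail m st" by (simp add: avail_def)
  from eaters_unavailable[OF ne this] \<open>fst st j' = 0\<close>
  show ?case by (simp add: flow_def)
qed simp

end


section \<open>Comparison of the truthful and the manipulated process\<close>

text \<open>Induction on the number of phases the two processes still have to run. Both advance by
  the shorter of the current phase lengths: at least one phase is completed, and a phase that is
  merely cut still counts as one by \<open>ps_step_flow\<close>.\<close>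

lemma joint_run_completes:
  assumes n_pos: "0 < n"
    and validP: "\<forall>k<n. valid_pref m (P k)"
    and validQ: "\<forall>k<n. valid_pref m (Q k)"
    and "joint_run n m P Q t st st'"
    and "avail m ((ps_step n m P ^^ r) st) = {}"
    and "avail m ((ps_step n m Q ^^ r') st') = {}"
  shows "\<exists>t. joint_run n m P Q t ((ps_step n m P ^^ r) st) ((ps_step n m Q ^^ r') st')"
  using assms(4-)
proof (induction "r + r'" arbitrary: r r' t st st' rule: less_induct)
  case less
  note runs = joint_run_runs[OF less.prems(1)]
  have empty_iff: "avail m st = {} \<longleftrightarrow> avail m st' = {}"
    using run_avail_empty_iff[OF n_pos validP runs(1)] run_avail_empty_iff[OF n_pos validQ runs(2)]
    by simp
  show ?case
  proof (cases "avail m st = {}")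
    case True
    then show ?thesis
      using less.prems(1) empty_iff
      by (auto simp: ps_iterate_exhausted[OF n_pos validP] ps_iterate_exhausted[OF n_pos validQ])
  next
    case False
    with empty_iff have ne: "avail m st \<noteq> {}" "avail m st' \<noteq> {}" by auto
    \<comment> \<open>Something is left now but nothing after the remaining phases, so at least one
      phase remains.\<close>
    obtain v where v: "r = Suc v" using less.prems(2) ne(1) by (cases r) auto
    obtain v' where v': "r' = Suc v'" using less.prems(3) ne(2) by (cases r') auto
    let ?l = "phase_len n m P st" and ?l' = "phase_len n m Q st'"
    let ?h = "min ?l ?l'"
    note pos = phase_len_pos[OF n_pos validP ne(1)] phase_len_pos[OF n_pos validQ ne(2)]
    have feas: "feasible n m P ?h st" "feasible n m Q ?h st'"
      using pos feasible_le_phase_len[OF n_pos validP ne(1), of ?h]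
        feasible_le_phase_len[OF n_pos validQ ne(2), of ?h] by auto
    note joint = joint_run.step[OF less.prems(1) feas]
    note full = ps_step_eq_flow[OF n_pos validP ne(1)] ps_step_eq_flow[OF n_pos validQ ne(2)]
    note it = v v' funpow_Suc_right o_apply
    consider "?l < ?l'" | "?l' < ?l" | "?l = ?l'" by linarith
    then show ?thesis
    proof cases
      case 1
      then have same: "ps_step n m Q (flow n m Q ?h st') = ps_step n m Q st'"
        using ps_step_flow[OF n_pos validQ ne(2), of ?h] pos by simp
      have "flow n m P ?h st = ps_step n m P st" using 1 full by simp
      then show ?thesis
        using less.hyps[of v r', OF _ joint] less.prems(2,3) by (simp add: it same del: funpow.simps)
    next
      case 2
      then have same: "ps_step n m P (flow n m P ?h st) = ps_step n m P st"
        using ps_step_flow[OF n_pos validP ne(1), of ?h] pos by simp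
      have "flow n m Q ?h st' = ps_step n m Q st'" using 2 full by simp
      then show ?thesis
        using less.hyps[of r v', OF _ joint] less.prems(2,3) by (simp add: it same del: funpow.simps)
    next
      case 3
      then have "flow n m P ?h st = ps_step n m P st" "flow n m Q ?h st' = ps_step n m Q st'"
        using full by simp_all
      then show ?thesis
        using less.hyps[of v v', OF _ joint] less.prems(2,3) by (simp add: it del: funpow.simps)
    qed
  qed
qed

text \<open>In each step the excess is summed over a set \<open>J\<close> fixed by the end of the
  step. There the differences over \<open>J\<close> are exactly the positive parts; at the start
  they are at most the positive parts. So sign changes during the step need no tracking, and only
  the rate of change over \<open>J\<close> matters.\<close>

lemma joint_run_excess_supply:
  assumes n_pos: "0 < n"
    and validP: "\<forall>k<n. valid_pref m (P k)"
    and validQ: "\<forall>k<n. valid_pref m (Q k)"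
    and others: "\<forall>k. k \<noteq> i \<longrightarrow> Q k = P k"
    and "joint_run n m P Q t st st'"
  shows "(\<Sum>j<m. max 0 (fst st' j - fst st j)) \<le> t"
  using assms(5)
proof (induction rule: joint_run.induct)
  case (step t st st' h)
  let ?A = "avail m st" and ?A' = "avail m st'"
  let ?w = "flow n m P h st" and ?w' = "flow n m Q h st'"
  from step.hyps have h: "0 \<le> h" and ne: "?A \<noteq> {}" "?A' \<noteq> {}" by (auto simp: feasible_def)
  note runs = joint_run_runs[OF step.hyps(1)] joint_run_runs[OF joint_run.step[OF step.hyps]]
  note nonneg = run_supply_nonneg[OF n_pos validP runs(1)] run_supply_nonneg[OF n_pos validQ runs(2)]
    run_supply_nonneg[OF n_pos validP runs(3)] run_supply_nonneg[OF n_pos validQ runs(4)]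
  \<comment> \<open>An item exhausted earlier in the manipulated process may run out in the truthful one exactly at
    the end of the step; its truthful eaters must not be counted, hence the restriction to the
    items still available.\<close>
  define J where "J = {j \<in> ?A'. fst ?w j \<le> fst ?w' j}"
  let ?K = "{k. k < n \<and> top_item (P k) ?A \<in> J}" and ?K' = "{k. k < n \<and> top_item (Q k) ?A' \<in> J}"
  have finJ: "finite J" and Jm: "J \<subseteq> {..<m}" by (auto simp: J_def avail_def)
  have le: "fst ?w j \<le> fst st j" "fst ?w' j \<le> fst st' j" for j
    using h by (simp_all add: flow_def)
  have zero: "max 0 (fst ?w' j - fst ?w j) = 0" if "j < m" "j \<notin> J" for j
  proof (cases "j \<in> ?A'")
    case True
    with that(2) show ?thesis by (simp add: J_def)
  next
    case False
    then have "fst st' j \<le> 0" using that(1) by (simp add: avail_def)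
    then show ?thesis using le(2)[of j] nonneg(3)[of j] by simp
  qed
  \<comment> \<open>Agents other than \<open>i\<close> report the same in both processes. If such an
    agent eats something better than its truthful item in the manipulated process, that item is
    exhausted under truth, hence has nonnegative excess and lies in \<open>J\<close>. Only
    \<open>i\<close> can add to the excess.\<close>
  have "?K \<subseteq> insert i ?K'"
  proof
    fix k assume k: "k \<in> ?K"
    let ?j = "top_item (P k) ?A" and ?j' = "top_item (P k) ?A'"
    have kn: "k < n" and j: "?j \<in> J" using k by auto
    then have "?j \<in> ?A'" "?j \<in> set (P k)"
      using valid_pref_mem[OF validP[rule_format, OF kn]] by (auto simp: J_def avail_def)
    then have "?j' \<in> insert ?j (better (P k) ?j)" by (rule top_item_weakly_better)
    moreover have "?j' \<in> J" if "?j' \<in> better (P k) ?j"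
    proof -
      have A': "?j' \<in> ?A'" by (rule top_item_avail[OF validP[rule_format, OF kn] ne(2)])
      have "?j' \<notin> ?A" using that better_top_item_disjoint[of "P k" ?A] by blast
      with A' have "fst st ?j' \<le> 0" by (auto simp: avail_def)
      then have "fst ?w ?j' \<le> fst ?w' ?j'"
        using le(1)[of ?j'] nonneg(4)[of ?j'] by linarith
      with A' show ?thesis by (simp add: J_def)
    qed
    ultimately have "?j' \<in> J" using j by auto
    then show "k \<in> insert i ?K'" using kn others by (cases "k = i") auto
  qed
  then have "card ?K \<le> card (insert i ?K')" by (intro card_mono) auto
  also have "\<dots> \<le> card ?K' + 1" by (simp add: card_insert_if)
  finally have "real (card ?K) \<le> real (card ?K') + 1" by linarith
  from mult_left_mono[OF this h] have cards: "h * real (card ?K) \<le> h * real (card ?K') + h"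
    by (simp add: distrib_left)
  have "(\<Sum>j<m. max 0 (fst ?w' j - fst ?w j)) = (\<Sum>j\<in>J. fst ?w' j - fst ?w j)"
    using Jm zero by (intro sum.mono_neutral_cong_right) (auto simp: J_def)
  also have "\<dots> = (\<Sum>j\<in>J. fst st' j - fst st j) - h * real (card ?K') + h * real (card ?K)"
    by (simp add: sum_subtractf sum_supply_flow[OF finJ])
  also have "\<dots> \<le> (\<Sum>j\<in>J. fst st' j - fst st j) + h"
    using cards by linarith
  also have "(\<Sum>j\<in>J. fst st' j - fst st j) \<le> (\<Sum>j\<in>J. max 0 (fst st' j - fst st j))"
    by (intro sum_mono) simp
  also have "\<dots> \<le> (\<Sum>j<m. max 0 (fst st' j - fst st j))"
    using Jm by (intro sum_mono2) auto
  also have "\<dots> \<le> t" by (rule step.IH)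
  finally show ?case by simp
qed simp

text \<open>The disjuncts are: \<open>S\<close> is not yet exhausted under truth; \<open>i\<close>
  has truthfully got a full unit of it; or \<open>X\<close> has been frozen at the exhaustion time
  of \<open>S\<close>. In the last case the gain from lying plus half the supply left in
  \<open>X\<close> is a potential that never rises, since each unit of \<open>S\<close> taken by
  \<open>i\<close> removes at least two units from \<open>X\<close>.\<close>

lemma joint_run_prefix_invariant:
  assumes n_pos: "0 < n"
    and validP: "\<forall>k<n. valid_pref m (P k)"
    and validQ: "\<forall>k<n. valid_pref m (Q k)"
    and others: "\<forall>k. k \<noteq> i \<longrightarrow> Q k = P k"
    and i: "i < n"
    and S: "S = set (take r (P i))" "S \<noteq> {}"
    and "joint_run n m P Q t st st'"
  shows "S \<inter> avail m st \<noteq> {} \<and> (\<Sum>j\<in>S. snd st i j) = t \<or>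
    1 \<le> (\<Sum>j\<in>S. snd st i j) \<or>
    (\<exists>X. finite X \<and>
      (\<forall>j\<in>S. \<exists>k<n. k \<noteq> i \<and> insert j (better (P k) j) \<subseteq> X) \<and>
      (\<Sum>j\<in>S. snd st' i j) + (\<Sum>j\<in>X. fst st' j) / 2 \<le> 3 / 2 * (\<Sum>j\<in>S. snd st i j))"
  using assms(8)
proof (induction rule: joint_run.induct)
  case start
  have "S \<subseteq> {..<m}"
    using valid_pref_prefix[OF validP[rule_format, OF i]] by (simp add: S(1))
  with S(2) show ?case by (auto simp: avail_def)
next
  case (step t st st' h)
  let ?A = "avail m st" and ?A' = "avail m st'"
  let ?w = "flow n m P h st" and ?w' = "flow n m Q h st'"
  let ?y = "\<lambda>st. \<Sum>j\<in>S. snd st i j"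
  from step.hyps have h: "0 \<le> h" and ne: "?A \<noteq> {}" "?A' \<noteq> {}" by (auto simp: feasible_def)
  note joint = joint_run.step[OF step.hyps]
  note run = joint_run_runs(1)[OF joint] and run' = joint_run_runs(2)[OF joint]
  have finS: "finite S" and Sm: "S \<subseteq> {..<m}"
    using valid_pref_prefix[OF validP[rule_format, OF i]] by (simp_all add: S(1))
  have y_w: "?y ?w = ?y st + (if top_item (P i) ?A \<in> S then h else 0)"
    and y_w': "?y ?w' = ?y st' + (if top_item (Q i) ?A' \<in> S then h else 0)"
    by (simp_all add: sum_eaten_flow[OF finS i])
  from step.IH show ?case
  proof (elim disjE exE conjE)
    assume "S \<inter> ?A \<noteq> {}" and y: "?y st = t"
    then have "top_item (P i) ?A \<in> S" unfolding S(1) by (intro top_item_prefix)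
    with y have y_eq: "?y ?w = t + h" by (simp add: y_w)
    show ?thesis
    proof (cases "S \<inter> avail m ?w = {} \<and> ?y ?w < 1")
      case False
      with y_eq show ?thesis by auto
    next
      case True
      \<comment> \<open>The truthful process exhausts \<open>S\<close> during this step;
        \<open>X\<close> collects everything it has exhausted by the end of the step.\<close>
      define X where "X = {j. j < m \<and> fst ?w j = 0}"
      have S0: "fst ?w j = 0" if "j \<in> S" for j
        using True that Sm run_supply_nonneg[OF n_pos validP run, of j]
        by (force simp: avail_def)
      have "\<exists>k<n. k \<noteq> i \<and> insert j (better (P k) j) \<subseteq> X" if j: "j \<in> S" for j
      proof -
        \<comment> \<open>Otherwise \<open>i\<close> alone would have eaten the whole unit of
          \<open>j\<close>, against the assumption that it got less than one unit of
          \<open>S\<close>.\<close>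
        have "\<exists>k<n. k \<noteq> i \<and> 0 < snd ?w k j"
        proof (rule ccontr)
          assume "\<not> ?thesis"
          then have "snd ?w k j \<le> 0" if "k \<in> {..<n} - {i}" for k
            using that by (metis DiffE insertCI lessThan_iff not_le)
          then have "(\<Sum>k\<in>{..<n} - {i}. snd ?w k j) \<le> 0"
            by (rule sum_nonpos)
          moreover have "(\<Sum>k<n. snd ?w k j) = 1"
            using run_item_balance[OF n_pos validP run, of j] S0[OF j] by simp
          ultimately have "1 \<le> snd ?w i j"
            using i by (simp add: sum.remove[of "{..<n}" i])
          also have "\<dots> \<le> ?y ?w"
            using j finS run_eaten_nonneg[OF n_pos validP run] by (intro member_le_sum) auto
          finally show False using True by simp
        qed
        then obtain k where k: "k < n" "k \<noteq> i" "0 < snd ?w k j" by blast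
        have "better (P k) j \<subseteq> X"
        proof
          fix j' assume j': "j' \<in> better (P k) j"
          then have "j' < m" by (rule valid_pref_better[OF validP[rule_format, OF k(1)]])
          then show "j' \<in> X"
            using run_eaten_imp_better_exhausted[OF n_pos validP run k(1,3) j']
            by (simp add: X_def)
        qed
        then show ?thesis using k S0[OF j] j Sm by (auto simp: X_def)
      qed
      moreover have "finite X" by (simp add: X_def)
      \<comment> \<open>By time \<open>t + h\<close> agent \<open>i\<close> has eaten at most
        \<open>t + h\<close> in total. On \<open>X\<close> the truthful supply is zero, so the
        manipulated supply there is pure excess, again at most \<open>t + h\<close>.\<close>
      moreover have "?y ?w' + (\<Sum>j\<in>X. fst ?w' j) / 2 \<le> 3 / 2 * ?y ?w"
      proof -
        have "?y ?w' \<le> (\<Sum>j<m. snd ?w' i j)"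
          using Sm run_eaten_nonneg[OF n_pos validQ run'] by (intro sum_mono2) auto
        also have "\<dots> = t + h" by (rule run_agent_total[OF n_pos validQ run' i])
        finally have "?y ?w' \<le> t + h" .
        moreover have "(\<Sum>j\<in>X. fst ?w' j) \<le> t + h"
        proof -
          have "(\<Sum>j\<in>X. fst ?w' j) \<le> (\<Sum>j\<in>X. max 0 (fst ?w' j - fst ?w j))"
            by (intro sum_mono) (simp add: X_def)
          also have "\<dots> \<le> (\<Sum>j<m. max 0 (fst ?w' j - fst ?w j))"
            by (intro sum_mono2) (auto simp: X_def)
          also have "\<dots> \<le> t + h"
            by (rule joint_run_excess_supply[OF n_pos validP validQ others joint])
          finally show ?thesis .
        qed
        ultimately show ?thesis by (simp add: y_eq)
      qed
      ultimately show ?thesis by blast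
    qed
  next
    assume "1 \<le> ?y st"
    with h show ?thesis by (simp add: y_w)
  next
    fix X
    assume X: "finite X" "\<forall>j\<in>S. \<exists>k<n. k \<noteq> i \<and> insert j (better (P k) j) \<subseteq> X"
      and IH: "?y st' + (\<Sum>j\<in>X. fst st' j) / 2 \<le> 3 / 2 * ?y st"
    let ?K = "{k. k < n \<and> top_item (Q k) ?A' \<in> X}"
    \<comment> \<open>If \<open>i\<close> eats \<open>j\<close> from \<open>S\<close>, then
      \<open>j\<close> is available, so the agent \<open>k\<close> attached to \<open>j\<close> eats
      \<open>j\<close> or something it prefers. Both choices lie in \<open>X\<close>, as does
      \<open>j\<close>, giving two distinct eaters of \<open>X\<close>.\<close>
    have "2 * (if top_item (Q i) ?A' \<in> S then h else 0) \<le> h * real (card ?K)"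
    proof (cases "top_item (Q i) ?A' \<in> S")
      case True
      let ?j = "top_item (Q i) ?A'"
      obtain k where k: "k < n" "k \<noteq> i" "insert ?j (better (P k) ?j) \<subseteq> X"
        using X(2) True by blast
      have "?j \<in> ?A'" by (rule top_item_avail[OF validQ[rule_format, OF i] ne(2)])
      moreover have "?j \<in> set (P k)"
        using True Sm valid_pref_mem[OF validP[rule_format, OF k(1)]] by auto
      ultimately have "top_item (P k) ?A' \<in> X"
        using top_item_weakly_better[of ?j ?A' "P k"] k(3) by blast
      then have "{i, k} \<subseteq> ?K" using i k others k(2) by auto
      then have "card {i, k} \<le> card ?K" by (intro card_mono) auto
      with k(2) have "2 \<le> real (card ?K)" by simp
      from mult_left_mono[OF this h] True show ?thesis by (simp add: mult.commute)
    qed (use h in simp)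
    moreover have "(\<Sum>j\<in>X. fst ?w' j) = (\<Sum>j\<in>X. fst st' j) - h * real (card ?K)"
      by (rule sum_supply_flow[OF X(1)])
    moreover have "?y st \<le> ?y ?w" using h by (simp add: y_w)
    ultimately have "?y ?w' + (\<Sum>j\<in>X. fst ?w' j) / 2 \<le> 3 / 2 * ?y ?w"
      using IH unfolding y_w' by argo
    with X show ?thesis by blast
  qed
qed

lemma ps_alloc_prefix_bound:
  assumes "m \<le> n" and i: "i < n"
    and validP: "\<forall>k<n. valid_pref m (P k)"
    and validq: "valid_pref m q"
  shows "(\<Sum>j\<in>set (take r (P i)). ps_alloc n m (P(i := q)) i j)
    \<le> 3 / 2 * (\<Sum>j\<in>set (take r (P i)). ps_alloc n m P i j)"
proof (cases "set (take r (P i)) = {}")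
  case False
  define Q where "Q = P(i := q)"
  define S where "S = set (take r (P i))"
  have ne: "S \<noteq> {}" using False by (simp add: S_def)
  have others: "\<forall>k. k \<noteq> i \<longrightarrow> Q k = P k" by (simp add: Q_def)
  have n_pos: "0 < n" using i by simp
  have validQ: "\<forall>k<n. valid_pref m (Q k)"
    using validP validq by (simp add: Q_def)
  define st where "st = (ps_step n m P ^^ m) ps_init"
  define st' where "st' = (ps_step n m Q ^^ m) ps_init"
  have "card (avail m ps_init) \<le> m" by (simp add: avail_def)
  then have exhausted: "avail m st = {}" "avail m st' = {}"
    unfolding st_def st'_def
    using avail_ps_iterate[OF n_pos validP] avail_ps_iterate[OF n_pos validQ] by blast+
  obtain t where joint: "joint_run n m P Q t st st'"
    using joint_run_completes[OF n_pos validP validQ joint_run.start] exhausted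
    unfolding st_def st'_def by blast
  note run = joint_run_runs(1)[OF joint] and run' = joint_run_runs(2)[OF joint]
  have "real n * t = real m"
    using run_avail_empty_iff[OF n_pos validP run] exhausted(1) by simp
  \<comment> \<open>This is where \<open>m \<le> n\<close> enters: no agent eats more than one unit
    in total.\<close>
  then have "t \<le> 1"
    using assms(1) n_pos by (metis mult.right_neutral mult_le_cancel_left_pos of_nat_0_less_iff of_nat_le_iff)
  have Sm: "S \<subseteq> {..<m}"
    using valid_pref_prefix[OF validP[rule_format, OF i]] by (simp add: S_def)
  have "(\<Sum>j\<in>S. snd st' i j) \<le> (\<Sum>j<m. snd st' i j)"
    using Sm run_eaten_nonneg[OF n_pos validQ run'] by (intro sum_mono2) auto
  also have "\<dots> = t" by (rule run_agent_total[OF n_pos validQ run' i])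
  finally have le1: "(\<Sum>j\<in>S. snd st' i j) \<le> 1" using \<open>t \<le> 1\<close> by linarith
  have remaining: "0 \<le> (\<Sum>j\<in>X. fst st' j)" for X
    by (intro sum_nonneg run_supply_nonneg[OF n_pos validQ run'])
  \<comment> \<open>At the end nothing is available, which rules out the first disjunct; the second
    is settled by \<open>le1\<close>, the third by dropping the nonnegative supply left in
    \<open>X\<close>.\<close>
  have "(\<Sum>j\<in>S. snd st' i j) \<le> 3 / 2 * (\<Sum>j\<in>S. snd st i j)"
    using joint_run_prefix_invariant[OF n_pos validP validQ others i S_def ne joint]
  proof (elim disjE exE conjE)
    assume "1 \<le> (\<Sum>j\<in>S. snd st i j)"
    with le1 show ?thesis by linarith
  next
    fix X
    assume "(\<Sum>j\<in>S. snd st' i j) + (\<Sum>j\<in>X. fst st' j) / 2 \<le> 3 / 2 * (\<Sum>j\<in>S. snd st i j)"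
    with remaining[of X] show ?thesis by linarith
  qed (use exhausted(1) in simp)
  then show ?thesis by (simp add: ps_alloc_def S_def Q_def st_def st'_def)
qed auto

section \<open>Abel summation and the utility bound\<close>

lemma weighted_sum_nonneg:
  fixes b d :: "nat \<Rightarrow> real"
  assumes "\<And>r. r < l \<Longrightarrow> 0 \<le> b r"
    and "\<And>r. Suc r < l \<Longrightarrow> b (Suc r) \<le> b r"
    and partial: "\<And>r. r \<le> l \<Longrightarrow> 0 \<le> (\<Sum>s<r. d s)"
  shows "0 \<le> (\<Sum>r<l. b r * d r)"
proof -
  \<comment> \<open>Abel summation as an induction: the last weight times the partial sum is a lower
    bound. Passing to the next, smaller weight preserves it because the partial sum is
    nonnegative.\<close>
  have "b r * (\<Sum>s<Suc r. d s) \<le> (\<Sum>s<Suc r. b s * d s)" if "r < l" for r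
    using that
  proof (induction r)
    case (Suc r)
    have "b (Suc r) * (\<Sum>s<Suc r. d s) \<le> b r * (\<Sum>s<Suc r. d s)"
      using Suc.prems assms(2) partial[of "Suc r"] by (intro mult_right_mono) auto
    also have "\<dots> \<le> (\<Sum>s<Suc r. b s * d s)" using Suc by simp
    finally show ?case by (simp add: distrib_left)
  qed simp
  from this[of "l - 1"] show ?thesis
    using assms(1)[of "l - 1"] partial[of l]
    by (cases l) (auto intro: order_trans[OF mult_nonneg_nonneg])
qed

theorem mainTheorem1:
  fixes n m i :: nat and P :: "nat \<Rightarrow> nat list" and q :: "nat list" and a :: "nat \<Rightarrow> real"
  assumes "m \<le> n"
    and "i < n"
    and "\<forall>k<n. valid_pref m (P k)"
    and "compatible_utils m (P i) a"
    and "valid_pref m q"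
  shows "ps_util n m (P(i := q)) a i \<le> 3 / 2 * ps_util n m P a i"
proof -
  let ?p = "P i"
  \<comment> \<open>The slack of the bound at item \<open>j\<close>. It may be negative for single
    items; only its sums over prefixes of the true preference are known to be nonnegative.\<close>
  define d where "d j = 3 / 2 * ps_alloc n m P i j - ps_alloc n m (P(i := q)) i j" for j
  have p: "distinct ?p" "set ?p = {..<m}"
    using assms(2,3) by (simp_all add: valid_pref_def lessThan_atLeast0)
  have sum_take: "(\<Sum>j\<in>set (take r ?p). f j) = (\<Sum>s<r. f (?p ! s))"
    if "r \<le> length ?p" for r and f :: "nat \<Rightarrow> real"
  proof -
    have "set (take r ?p) = (!) ?p ` {..<r}"
      using nth_image[OF that] by (simp add: lessThan_atLeast0)
    moreover have "inj_on ((!) ?p) {..<r}"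
      using p(1) that by (auto intro!: inj_on_nth)
    ultimately show ?thesis by (simp add: sum.reindex)
  qed
  have "0 \<le> (\<Sum>r<length ?p. a (?p ! r) * d (?p ! r))"
  proof (rule weighted_sum_nonneg)
    fix r assume r: "r < length ?p"
    then have "?p ! r < m" using p(2) nth_mem by blast
    then show "0 \<le> a (?p ! r)" using assms(4) by (simp add: compatible_utils_def)
  next
    fix r assume "Suc r < length ?p"
    then show "a (?p ! Suc r) \<le> a (?p ! r)"
      using assms(4) by (auto simp: compatible_utils_def intro: less_imp_le)
  next
    fix r assume r: "r \<le> length ?p"
    show "0 \<le> (\<Sum>s<r. d (?p ! s))"
      using ps_alloc_prefix_bound[of m n i P q r] assms sum_take[OF r, of d]
      by (simp add: d_def sum_subtractf sum_distrib_left)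
  qed
  also have "\<dots> = (\<Sum>j<m. a j * d j)"
    using sum_take[of "length ?p" "\<lambda>j. a j * d j"] p(2) by simp
  also have "\<dots> = 3 / 2 * ps_util n m P a i - ps_util n m (P(i := q)) a i"
    by (simp add: ps_util_def d_def sum_subtractf sum_distrib_left algebra_simps)
  finally show ?thesis by simp
qed

end
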